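(* Let $q$ be a power of an odd prime and let $m,d$ be positive integers with $q-1=md$ and $d$ even. Let $u,v\in\mathbb{F}_q^{\ast}$ be two distinct elements, both of multiplicative order $m$. Put $a=(v-u)/2$, $b=(u+v)/2$ and $f(x)=ax^{(q+1)/2}+bx\in\mathbb{F}_q[x]$. Then: (i) $f$ is a permutation polynomial of $\mathbb{F}_q$; (ii) the permutation of $\mathbb{F}_q$ induced by $f$ has cycle type $1+m^d$; (iii) the inverse permutation is induced by the binomial $a'x^{(q+1)/2}+b'x$, where $a'=(v^{-1}-u^{-1})/2$ and $b'=(u^{-1}+v^{-1})/2$.
   Context: The order of a nonzero element of $\mathbb{F}_q$ means its order in the multiplicative group $\mathbb{F}_q^{\ast}$. A cycle type written $1+m_0^{k_0}+m_1^{k_1}+\cdots$ means the permutation has exactly one fixed point and, besides it, its disjoint cycle decomposition consists of $k_0$ cycles of length $m_0$, $k_1$ cycles of length $m_1$, etc.; in particular $1+m^d$ means one fixed point and $d$ disjoint cycles each of length $m$. *)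

theory Defs
  imports
    "HOL-Library.Cardinality"
    "HOL-Computational_Algebra.Computational_Algebra"
    "HOL-Combinatorics.Combinatorics"
begin

definition mult_order :: "'a::field \<Rightarrow> nat" where
  "mult_order x = (LEAST n. 0 < n \<and> x ^ n = 1)"

definition permutation_poly :: "'a::{field,finite} poly \<Rightarrow> bool" where
  "permutation_poly f \<longleftrightarrow> bij (poly f)"

text \<open>The supports of the disjoint cycles of a permutation are its orbits, a fixed point
  counting as a cycle of length 1. The qualifier selects the orbit of a function on a type
  rather than the one for the type of finitely supported permutations.\<close>

definition cycle_type :: "('a::finite \<Rightarrow> 'a) \<Rightarrow> nat multiset" where
  "cycle_type p = image_mset card (mset_set (range (Orbits.orbit p)))"

end

(* Let chi(x) = x^((q-1)/2), which is 1 or -1 for every nonzero x. Then f(x) = v x if chi(x) = 1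
   and f(x) = u x if chi(x) = -1. As d is even, m divides (q-1)/2, so chi(u) = chi(v) = 1 and f
   preserves chi. Hence f acts on every nonzero orbit as multiplication by one fixed element of
   order m, and the map built from the inverses of u and v undoes it. *)
theory Submission
  imports Defs
begin

text \<open>Translation by 1 permutes the field, so comparing the sum of all elements before and
  after gives \<open>of_nat CARD('a) = 0\<close>. If 2 vanished, an odd cardinality would map to 1
  instead.\<close>

lemma two_neq_0_of_odd_card:
  assumes "odd CARD('a::{field,finite})"
  shows "(2 :: 'a) \<noteq> 0"
proof
  assume "(2 :: 'a) = 0"
  have "(\<Sum>y\<in>UNIV. y) + of_nat CARD('a) = (\<Sum>y\<in>UNIV. y + 1 :: 'a)"
    by (simp add: sum.distrib)
  also have "\<dots> = (\<Sum>y\<in>UNIV. y)"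
    by (rule sum.reindex_bij_witness[of _ "\<lambda>y. y - 1" "\<lambda>y. y + 1"]) auto
  finally have "of_nat CARD('a) = (0 :: 'a)"
    by simp
  then show False
    using assms \<open>2 = 0\<close> by (auto elim!: oddE)
qed

text \<open>Multiplication by \<open>x\<close> permutes the nonzero elements, so their product,
  itself nonzero, absorbs the factor \<open>x ^ (CARD('a) - 1)\<close>.\<close>

lemma power_card_minus_1_eq_1:
  fixes x :: "'a::{field,finite}"
  assumes "x \<noteq> 0"
  shows "x ^ (CARD('a) - 1) = 1"
proof -
  have "x ^ (CARD('a) - 1) * \<Prod>(UNIV - {0}) = (\<Prod>y\<in>UNIV - {0}. x * y)"
    by (simp add: prod.distrib card_Diff_singleton)
  also have "\<dots> = \<Prod>(UNIV - {0})"
    by (rule prod.reindex_bij_witness[of _ "\<lambda>y. y / x" "\<lambda>y. x * y"]) (use assms in auto)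
  finally show ?thesis
    by simp
qed

lemma power_half_card_cases:
  fixes x :: "'a::{field,finite}"
  assumes "odd CARD('a)" and "x \<noteq> 0"
  shows "x ^ ((CARD('a) - 1) div 2) = 1 \<or> x ^ ((CARD('a) - 1) div 2) = - 1"
proof -
  have "x ^ (CARD('a) - 1) = 1"
    by (rule power_card_minus_1_eq_1) fact
  moreover have "(CARD('a) - 1) div 2 * 2 = CARD('a) - 1"
    using assms(1) by simp
  ultimately have "(x ^ ((CARD('a) - 1) div 2))\<^sup>2 = 1"
    by (simp flip: power_mult)
  then show ?thesis
    by (simp add: power2_eq_1_iff)
qed

text \<open>One factor \<open>x\<close> splits off, leaving a coefficient affine in the half power,
  whose value at 1 is \<open>v\<close> and at -1 is \<open>u\<close>. At \<open>x = 0\<close> both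
  sides vanish whichever branch is taken.\<close>

lemma poly_half_card_binomial:
  fixes u v x :: "'a::{field,finite}"
  assumes "odd CARD('a)"
  shows "poly (monom ((v - u) / 2) ((CARD('a) + 1) div 2) + monom ((u + v) / 2) 1) x
    = (if x ^ ((CARD('a) - 1) div 2) = 1 then v else u) * x"
proof -
  note two = two_neq_0_of_odd_card[OF assms]
  \<comment> \<open>Separates the two values of the half power, so that -1 really selects the branch
    \<open>u\<close>.\<close>
  then have "(1 :: 'a) \<noteq> - 1"
    by (metis one_add_one add.right_inverse)
  have "(CARD('a) + 1) div 2 = Suc ((CARD('a) - 1) div 2)"
    using assms by (auto elim!: oddE)
  then have expand: "poly (monom ((v - u) / 2) ((CARD('a) + 1) div 2) + monom ((u + v) / 2) 1) x
    = ((v - u) / 2 * x ^ ((CARD('a) - 1) div 2) + (u + v) / 2) * x"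
    by (simp add: poly_monom algebra_simps)
  show ?thesis
  proof (cases "x = 0")
    case True
    then show ?thesis
      unfolding expand by simp
  next
    case False
    from power_half_card_cases[OF assms this] show ?thesis
    proof
      assume *: "x ^ ((CARD('a) - 1) div 2) = 1"
      have "(v - u) / 2 + (u + v) / 2 = 2 * v / 2"
        unfolding add_divide_distrib[symmetric] by (simp add: algebra_simps)
      then have "(v - u) / 2 + (u + v) / 2 = v"
        using two by simp
      with * show ?thesis
        unfolding expand by simp
    next
      assume *: "x ^ ((CARD('a) - 1) div 2) = - 1"
      have "- ((v - u) / 2) + (u + v) / 2 = 2 * u / 2"
        unfolding minus_divide_left add_divide_distrib[symmetric] by (simp add: algebra_simps)
      then have "- ((v - u) / 2) + (u + v) / 2 = u"
        using two by simp
      with * \<open>1 \<noteq> - 1\<close> show ?thesis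
        unfolding expand by simp
    qed
  qed
qed

lemma power_mult_order_eq_1:
  fixes x :: "'a::{field,finite}"
  assumes "x \<noteq> 0"
  shows "x ^ mult_order x = 1"
proof -
  \<comment> \<open>Makes \<open>CARD('a) - 1\<close> positive, hence an admissible exponent for the
    \<open>LEAST\<close> in \<open>mult_order\<close>.\<close>
  have "CARD('a) \<noteq> 1"
    by (metis UNIV_I card_1_singletonE singletonD zero_neq_one)
  then have "0 < CARD('a) - 1 \<and> x ^ (CARD('a) - 1) = 1"
    using power_card_minus_1_eq_1[OF assms] zero_less_card_finite[where 'a = 'a]
    by linarith
  then show ?thesis
    unfolding mult_order_def by (rule LeastI2) simp
qed

text \<open>Two equal powers could be cancelled to give an exponent \<open>j - i\<close> that is
  positive, below the order, and sends \<open>x\<close> to 1, against minimality.\<close>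

lemma inj_on_power_mult_order:
  assumes "x \<noteq> 0"
  shows "inj_on (\<lambda>n. x ^ n) {..<mult_order x}"
proof (rule inj_onI)
  have less: "x ^ i \<noteq> x ^ j" if "i < j" "j < mult_order x" for i j
  proof
    assume eq: "x ^ i = x ^ j"
    have "x ^ j = x ^ i * x ^ (j - i)"
      using that(1) by (simp flip: power_add)
    then have "x ^ (j - i) = 1"
      using eq assms by simp
    moreover have "0 < j - i" "j - i < mult_order x"
      using that by auto
    ultimately show False
      unfolding mult_order_def using not_less_Least by blast
  qed
  fix i j
  assume "i \<in> {..<mult_order x}" "j \<in> {..<mult_order x}" "x ^ i = x ^ j"
  then show "i = j"
    using less by (metis lessThan_iff linorder_neqE_nat)
qed

text \<open>The first hypothesis concerns the iterates at \<open>x\<close> alone, since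
  \<open>f\<close> may multiply by another constant on other orbits.\<close>

lemma card_orbit_mult:
  fixes w x :: "'a::{field,finite}"
  assumes "\<And>n. (f ^^ n) x = w ^ n * x" and "w \<noteq> 0" and "x \<noteq> 0" and "0 < mult_order w"
  shows "card (Orbits.orbit f x) = mult_order w"
proof -
  have "(f ^^ mult_order w) x = x"
    using assms(1,2) by (simp add: power_mult_order_eq_1)
  \<comment> \<open>The return to \<open>x\<close> after \<open>mult_order w\<close> steps bounds
    the iterates that have to be listed.\<close>
  then have "Orbits.orbit f x = (\<lambda>n. w ^ n * x) ` {..<mult_order w}"
    using assms(1,4) by (auto simp: orbit_altdef_bounded)
  moreover have "inj_on (\<lambda>n. w ^ n * x) {..<mult_order w}"
    using inj_on_power_mult_order[OF assms(2)] assms(3) by (simp add: inj_on_def)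
  ultimately show ?thesis
    by (simp add: card_image)
qed

text \<open>The orbits of a permutation partition the type. Away from \<open>z\<close> they cut
  \<open>m * d\<close> points into blocks of size \<open>m\<close>, so counting points gives the
  number of blocks.\<close>

lemma cycle_type_one_fixed_point:
  fixes f :: "'a::finite \<Rightarrow> 'a"
  assumes "bij f" and "f z = z" and "0 < m" and "CARD('a) - 1 = m * d"
    and card: "\<And>x. x \<noteq> z \<Longrightarrow> card (Orbits.orbit f x) = m"
  shows "cycle_type f = {#1#} + replicate_mset d m"
proof -
  define C where "C = Orbits.orbit f ` (UNIV - {z})"
  have perm: "permutation f"
    using assms(1) by (simp add: permutation)
  have self: "x \<in> Orbits.orbit f x" for x
    by (rule permutation_self_in_orbit[OF perm])
  have eq: "Orbits.orbit f y = Orbits.orbit f x" if "y \<in> Orbits.orbit f x" for x y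
    using that self by (meson orbit_swap orbit_trans subset_antisym subsetI)
  have fixed: "Orbits.orbit f z = {z}"
    using assms(2) by (simp add: orbit_eq_singleton_iff)
  \<comment> \<open>Otherwise the orbit of \<open>x\<close> would be that of \<open>z\<close>,
    namely \<open>{z}\<close>, yet it contains \<open>x\<close>.\<close>
  have z: "z \<notin> Orbits.orbit f x" if "x \<noteq> z" for x
    using eq[of z x] fixed self[of x] that by auto
  have "\<Union>C = UNIV - {z}"
    unfolding C_def using self z by auto
  moreover have "m * card C = card (\<Union>C)"
  proof (rule card_partition)
    show "c1 \<inter> c2 = {}" if "c1 \<in> C" "c2 \<in> C" "c1 \<noteq> c2" for c1 c2
      using that eq unfolding C_def by (metis disjoint_iff imageE)
  qed (use card in \<open>auto simp: C_def\<close>)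
  ultimately have "card C = d"
    using assms(3,4) by (simp add: card_Diff_singleton)
  have "range (Orbits.orbit f) = insert {z} C"
    unfolding C_def using fixed by auto
  \<comment> \<open>Ensures that inserting \<open>{z}\<close> adds a new entry to the multiset, even
    when \<open>m = 1\<close> and the members of \<open>C\<close> are singletons too.\<close>
  moreover have "{z} \<notin> C"
    unfolding C_def using z by auto
  ultimately have "cycle_type f = {#1#} + image_mset card (mset_set C)"
    unfolding cycle_type_def by simp
  also have "image_mset card (mset_set C) = image_mset (\<lambda>_. m) (mset_set C)"
    by (rule image_mset_cong) (use card in \<open>auto simp: C_def\<close>)
  also have "\<dots> = replicate_mset d m"
    using \<open>card C = d\<close> by (simp add: image_mset_const_eq)
  finally show ?thesis .
qed

theorem mainTheorem1:
  fixes p k q m d :: nat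
    and u v a b a' b' :: "'a::{field,finite}"
    and f :: "'a poly"
  assumes "prime p" and "odd p" and "0 < k" and "q = p ^ k"
    and "CARD('a) = q"
    and "0 < m" and "0 < d" and "q - 1 = m * d" and "even d"
    and "u \<noteq> 0" and "v \<noteq> 0" and "u \<noteq> v"
    and "mult_order u = m" and "mult_order v = m"
    and "a = (v - u) / 2" and "b = (u + v) / 2"
    and "f = monom a ((q + 1) div 2) + monom b 1"
    and "a' = (inverse v - inverse u) / 2" and "b' = (inverse u + inverse v) / 2"
  shows "permutation_poly f
    \<and> cycle_type (poly f) = {#1#} + replicate_mset d m
    \<and> inv (poly f) = poly (monom a' ((q + 1) div 2) + monom b' 1)"
proof -
  define \<chi> :: "'a \<Rightarrow> 'a" where "\<chi> x = x ^ ((q - 1) div 2)" for x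
  define g where "g = monom a' ((q + 1) div 2) + monom b' 1"
  have odd: "odd CARD('a)"
    using assms(2,4,5) by simp
  have f: "poly f x = (if \<chi> x = 1 then v else u) * x" for x
    using poly_half_card_binomial[OF odd, of v u x] unfolding \<chi>_def assms(5,15-17) .
  \<comment> \<open>\<open>a'\<close> and \<open>b'\<close> arise from \<open>a\<close> and
    \<open>b\<close> by inverting \<open>u\<close> and \<open>v\<close>, so the same evaluation
    applies.\<close>
  have g: "poly g x = (if \<chi> x = 1 then inverse v else inverse u) * x" for x
    using poly_half_card_binomial[OF odd, of "inverse v" "inverse u" x]
    unfolding \<chi>_def g_def assms(5,18,19) .
  have \<chi>_mult: "\<chi> (x * y) = \<chi> x * \<chi> y" for x y
    by (simp add: \<chi>_def power_mult_distrib)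
  have \<chi>_order: "\<chi> w = 1" if "w \<noteq> 0" "mult_order w = m" for w
  proof -
    have "(q - 1) div 2 = m * (d div 2)"
      using assms(8,9) by (simp add: div_mult_swap)
    then show ?thesis
      using power_mult_order_eq_1[OF that(1)] that(2) by (simp add: \<chi>_def power_mult)
  qed
  have \<chi>_uv: "\<chi> u = 1" "\<chi> v = 1"
    using \<chi>_order assms(10,11,13,14) by auto
  then have \<chi>_inv: "\<chi> (inverse u) = 1" "\<chi> (inverse v) = 1"
    by (simp_all add: \<chi>_def power_inverse)
  \<comment> \<open>All four multipliers have \<open>\<chi>\<close> equal to 1, so the first map
    leaves \<open>\<chi> x\<close> unchanged and the second picks the inverse of the multiplier just
    used.\<close>
  have gf: "poly g (poly f x) = x" and fg: "poly f (poly g x) = x" for x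
    using assms(10,11) by (simp_all add: f g \<chi>_mult \<chi>_uv \<chi>_inv)
  have "bij (poly f)"
    by (rule o_bij[of "poly g"]) (simp_all add: fun_eq_iff gf fg)
  moreover have "inv (poly f) = poly g"
    using gf fg by (rule inv_equality)
  moreover have "cycle_type (poly f) = {#1#} + replicate_mset d m"
  proof (rule cycle_type_one_fixed_point[where z = 0])
    fix x :: 'a
    assume "x \<noteq> 0"
    define w where "w = (if \<chi> x = 1 then v else u)"
    have w: "w \<noteq> 0" "mult_order w = m" "\<chi> w = 1"
      using assms(10,11,13,14) \<chi>_uv by (auto simp: w_def)
    \<comment> \<open>The multiplier depends on a point only through \<open>\<chi>\<close>, so it
      stays equal to \<open>w\<close> along the whole orbit of \<open>x\<close>.\<close>
    have \<chi>_power: "\<chi> (w ^ n * x) = \<chi> x" for n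
      by (induction n) (simp_all add: \<chi>_mult w(3) mult.assoc)
    have "(poly f ^^ n) x = w ^ n * x" for n
      by (induction n) (simp_all add: f \<chi>_power w_def[symmetric] mult.assoc)
    then show "card (Orbits.orbit (poly f) x) = m"
      using card_orbit_mult[of "poly f" x w] w(1,2) \<open>x \<noteq> 0\<close> assms(6) by simp
  qed (use \<open>bij (poly f)\<close> assms(5,6,8) in \<open>simp_all add: f\<close>)
  ultimately show ?thesis
    by (simp add: permutation_poly_def g_def)
qed

end
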